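(* Let $\mathfrak g_1,\mathfrak g_2$ be Lie superalgebras, $M_i$ a $\mathfrak g_i$-module ($i=1,2$), ${}^t\colon\mathfrak g_2\to\mathfrak g_1$ an even linear isomorphism and $\Psi\colon M_1\otimes M_2\to\mathbb C$ a non-degenerate even pairing. For $n\ge0$ define $\Psi_n\colon C^n(\mathfrak g_1,M_1)\otimes C_n(\mathfrak g_2,M_2)\to\mathbb C$ by $\Psi_n(f\otimes(\alpha\otimes x_1\cdots x_n))=(-1)^{\bar x_1+\cdots+\bar x_n}\Psi(f({}^tx_n\cdots{}^tx_1)\otimes\alpha)$. Then $\Psi_{n+1}(d_nf\otimes P)=\Psi_n(f\otimes\partial_{n+1}P)$ holds for all $n$, $f$, $P$ if and only if (P1) ${}^t$ is an anti-isomorphism of Lie superalgebras and (P2) $\Psi(m_1\otimes x.m_2)=\Psi({}^tx.m_1\otimes m_2)$ for all $x\in\mathfrak g_2$, $m_i\in M_i$.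
   Context: For a Lie superalgebra $\mathfrak g$ and module $M$: $C^n(\mathfrak g,M)=\mathrm{Hom}_{\mathbb C}(\mathrm{Sym}^n(\Pi\mathfrak g),M)$ with $d_nf(x_1\cdots x_{n+1})=\sum_i(-1)^{A_i}x_if(x_1\cdots\hat x_i\cdots x_{n+1})+\sum_{i<j}(-1)^{A_{i,j}}f([x_i,x_j]x_1\cdots\hat x_i\cdots\hat x_j\cdots x_{n+1})$, where $A_i=\bar x_i+(\bar f+k_{i-1})(\bar x_i+1)$, $A_{i,j}=\bar f+(k_{i-1}+1)(\bar x_i+1)+(k_{j-1}+\bar x_i+1)(\bar x_j+1)$, $k_i=\bar x_1+\cdots+\bar x_i+i$; and $C_n(\mathfrak g,M)=M\otimes\mathrm{Sym}^n(\Pi\mathfrak g)$ with $\partial_n(\alpha\otimes x_1\cdots x_n)=\sum_i(-1)^{B_i}(x_i\alpha)\otimes x_1\cdots\hat x_i\cdots x_n+\sum_{i<j}(-1)^{B_{i,j}}\alpha\otimes[x_i,x_j]x_1\cdots\hat x_i\cdots\hat x_j\cdots x_n$, where $B_i=(\bar\alpha+k_{i-1})(\bar x_i+1)$, $B_{i,j}=1+\bar\alpha+(k_{i-1}+1)(\bar x_i+1)+(k_{j-1}+\bar x_i+1)(\bar x_j+1)$. $\Pi$ is parity change and bars denote parities. *)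

theory Defs
  imports Complex_Main
begin

text \<open>Complex super vector spaces, represented by a scalar multiplication
  sc :: complex => 'v => 'v and a grading V :: nat => 'v set
  (V 0 = even part, V 1 = odd part).\<close>

definition super_space :: "(complex \<Rightarrow> 'v::ab_group_add \<Rightarrow> 'v) \<Rightarrow> (nat \<Rightarrow> 'v set) \<Rightarrow> bool" where
  "super_space sc V \<longleftrightarrow> vector_space sc \<and> module.subspace sc (V 0) \<and> module.subspace sc (V 1)
     \<and> (\<forall>v. \<exists>!ab. fst ab \<in> V 0 \<and> snd ab \<in> V 1 \<and> v = fst ab + snd ab)"

definition homog :: "(nat \<Rightarrow> 'v set) \<Rightarrow> 'v \<Rightarrow> bool" where
  "homog V x \<longleftrightarrow> x \<in> V 0 \<or> x \<in> V 1"

text \<open>Parity of a homogeneous element (the zero vector is given parity 0;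
  every expression below is multilinear, so this choice is immaterial).\<close>
definition par :: "(nat \<Rightarrow> 'v::zero set) \<Rightarrow> 'v \<Rightarrow> nat" where
  "par V x = (if x \<in> V 1 \<and> x \<noteq> 0 then 1 else 0)"

definition proj :: "(nat \<Rightarrow> 'v::ab_group_add set) \<Rightarrow> nat \<Rightarrow> 'v \<Rightarrow> 'v" where
  "proj V q m = (THE a. a \<in> V (q mod 2) \<and> m - a \<in> V (Suc q mod 2))"

abbreviation sgn :: "nat \<Rightarrow> complex" where
  "sgn A \<equiv> (-1) ^ A"

definition bilinear_map :: "(complex \<Rightarrow> 'a::ab_group_add \<Rightarrow> 'a) \<Rightarrow> (complex \<Rightarrow> 'b::ab_group_add \<Rightarrow> 'b) \<Rightarrow> (complex \<Rightarrow> 'c::ab_group_add \<Rightarrow> 'c)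
    \<Rightarrow> ('a \<Rightarrow> 'b \<Rightarrow> 'c) \<Rightarrow> bool" where
  "bilinear_map s1 s2 s3 b \<longleftrightarrow> (\<forall>x. Vector_Spaces.linear s2 s3 (b x)) \<and> (\<forall>y. Vector_Spaces.linear s1 s3 (\<lambda>x. b x y))"

definition lie_superalgebra :: "(complex \<Rightarrow> 'g::ab_group_add \<Rightarrow> 'g) \<Rightarrow> (nat \<Rightarrow> 'g set) \<Rightarrow> ('g \<Rightarrow> 'g \<Rightarrow> 'g) \<Rightarrow> bool" where
  "lie_superalgebra sc V br \<longleftrightarrow> super_space sc V \<and> bilinear_map sc sc sc br
    \<and> (\<forall>p q x y. p < 2 \<longrightarrow> q < 2 \<longrightarrow> x \<in> V p \<longrightarrow> y \<in> V q \<longrightarrow> br x y \<in> V ((p + q) mod 2))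
    \<and> (\<forall>x y. homog V x \<longrightarrow> homog V y \<longrightarrow> br x y = sc (- sgn (par V x * par V y)) (br y x))
    \<and> (\<forall>x y z. homog V x \<longrightarrow> homog V y \<longrightarrow> homog V z \<longrightarrow>
         br x (br y z) = br (br x y) z + sc (sgn (par V x * par V y)) (br y (br x z)))"

definition lie_supermodule :: "(complex \<Rightarrow> 'g::ab_group_add \<Rightarrow> 'g) \<Rightarrow> (nat \<Rightarrow> 'g set) \<Rightarrow> ('g \<Rightarrow> 'g \<Rightarrow> 'g)
    \<Rightarrow> (complex \<Rightarrow> 'm::ab_group_add \<Rightarrow> 'm) \<Rightarrow> (nat \<Rightarrow> 'm set) \<Rightarrow> ('g \<Rightarrow> 'm \<Rightarrow> 'm) \<Rightarrow> bool" where
  "lie_supermodule sc V br scm W act \<longleftrightarrow> super_space scm W \<and> bilinear_map sc scm scm act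
    \<and> (\<forall>p q x m. p < 2 \<longrightarrow> q < 2 \<longrightarrow> x \<in> V p \<longrightarrow> m \<in> W q \<longrightarrow> act x m \<in> W ((p + q) mod 2))
    \<and> (\<forall>x y m. homog V x \<longrightarrow> homog V y \<longrightarrow>
         act (br x y) m = act x (act y m) - scm (sgn (par V x * par V y)) (act y (act x m)))"

definition even_linear_iso :: "(complex \<Rightarrow> 'a::ab_group_add \<Rightarrow> 'a) \<Rightarrow> (nat \<Rightarrow> 'a set) \<Rightarrow> (complex \<Rightarrow> 'b::ab_group_add \<Rightarrow> 'b) \<Rightarrow> (nat \<Rightarrow> 'b set)
    \<Rightarrow> ('a \<Rightarrow> 'b) \<Rightarrow> bool" where
  "even_linear_iso s1 V1 s2 V2 f \<longleftrightarrow> Vector_Spaces.linear s1 s2 f \<and> bij f \<and> (\<forall>p<2. f ` V1 p \<subseteq> V2 p)"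

definition lie_anti_iso :: "(complex \<Rightarrow> 'a::ab_group_add \<Rightarrow> 'a) \<Rightarrow> ('a \<Rightarrow> 'a \<Rightarrow> 'a) \<Rightarrow> (complex \<Rightarrow> 'b::ab_group_add \<Rightarrow> 'b) \<Rightarrow> ('b \<Rightarrow> 'b \<Rightarrow> 'b)
    \<Rightarrow> ('a \<Rightarrow> 'b) \<Rightarrow> bool" where
  "lie_anti_iso s1 br1 s2 br2 f \<longleftrightarrow> Vector_Spaces.linear s1 s2 f \<and> bij f \<and> (\<forall>x y. f (br1 x y) = br2 (f y) (f x))"

definition nondeg_even_pairing :: "(complex \<Rightarrow> 'm::ab_group_add \<Rightarrow> 'm) \<Rightarrow> (nat \<Rightarrow> 'm set) \<Rightarrow> (complex \<Rightarrow> 'n::ab_group_add \<Rightarrow> 'n) \<Rightarrow> (nat \<Rightarrow> 'n set)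
    \<Rightarrow> ('m \<Rightarrow> 'n \<Rightarrow> complex) \<Rightarrow> bool" where
  "nondeg_even_pairing s1 W1 s2 W2 psi \<longleftrightarrow> bilinear_map s1 s2 (*) psi
    \<and> (\<forall>p q m n. p < 2 \<longrightarrow> q < 2 \<longrightarrow> p \<noteq> q \<longrightarrow> m \<in> W1 p \<longrightarrow> n \<in> W2 q \<longrightarrow> psi m n = 0)
    \<and> (\<forall>m. (\<forall>n. psi m n = 0) \<longrightarrow> m = 0) \<and> (\<forall>n. (\<forall>m. psi m n = 0) \<longrightarrow> n = 0)"

definition del :: "nat \<Rightarrow> 'a list \<Rightarrow> 'a list" where
  "del i xs = take i xs @ drop (Suc i) xs"

text \<open>kk V xs i = sum over l < i of (parity(x_l) + 1); this is k_{i-1} of the paper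
  for the 0-indexed position i.\<close>
definition kk :: "(nat \<Rightarrow> 'g::zero set) \<Rightarrow> 'g list \<Rightarrow> nat \<Rightarrow> nat" where
  "kk V xs i = (\<Sum>l<i. par V (xs ! l) + 1)"

text \<open>Cochains C^n(g,M) = Hom(Sym^n(Pi g), M), represented as multilinear maps on
  lists of length n which are supersymmetric w.r.t. the parity-shifted grading.\<close>
definition cochain :: "(complex \<Rightarrow> 'g::ab_group_add \<Rightarrow> 'g) \<Rightarrow> (nat \<Rightarrow> 'g set) \<Rightarrow> (complex \<Rightarrow> 'm::ab_group_add \<Rightarrow> 'm)
    \<Rightarrow> nat \<Rightarrow> ('g list \<Rightarrow> 'm) \<Rightarrow> bool" where
  "cochain sc V scm n f \<longleftrightarrow>
     (\<forall>xs i. length xs = n \<longrightarrow> i < n \<longrightarrow> Vector_Spaces.linear sc scm (\<lambda>y. f (xs[i := y])))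
   \<and> (\<forall>xs i. length xs = n \<longrightarrow> Suc i < n \<longrightarrow> homog V (xs ! i) \<longrightarrow> homog V (xs ! Suc i) \<longrightarrow>
        f (xs[i := xs ! Suc i, Suc i := xs ! i])
          = scm (sgn ((par V (xs ! i) + 1) * (par V (xs ! Suc i) + 1))) (f xs))"

text \<open>Homogeneous component of parity p of a cochain, evaluated on homogeneous
  arguments xs (x_1...x_n has degree kk V xs (length xs) in Sym^n(Pi g)).\<close>
definition fcomp :: "(nat \<Rightarrow> 'g::zero set) \<Rightarrow> (nat \<Rightarrow> 'm::ab_group_add set) \<Rightarrow> nat \<Rightarrow> ('g list \<Rightarrow> 'm) \<Rightarrow> 'g list \<Rightarrow> 'm" where
  "fcomp V W p f xs = proj W (p + kk V xs (length xs)) (f xs)"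

text \<open>The differential d_n applied to the parity-p component (fbar = p),
  evaluated on a homogeneous list xs = [x_1,...,x_{n+1}].\<close>
definition dpart :: "(complex \<Rightarrow> 'm::ab_group_add \<Rightarrow> 'm) \<Rightarrow> (nat \<Rightarrow> 'g::zero set) \<Rightarrow> ('g \<Rightarrow> 'g \<Rightarrow> 'g)
    \<Rightarrow> (nat \<Rightarrow> 'm set) \<Rightarrow> ('g \<Rightarrow> 'm \<Rightarrow> 'm) \<Rightarrow> nat \<Rightarrow> ('g list \<Rightarrow> 'm) \<Rightarrow> 'g list \<Rightarrow> 'm" where
  "dpart scm V br W act p f xs =
     (\<Sum>i<length xs. scm (sgn (par V (xs ! i) + (p + kk V xs i) * (par V (xs ! i) + 1)))
                       (act (xs ! i) (fcomp V W p f (del i xs))))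
   + (\<Sum>(i,j)\<in>{(i,j). i < j \<and> j < length xs}.
        scm (sgn (p + (kk V xs i + 1) * (par V (xs ! i) + 1)
                    + (kk V xs j + par V (xs ! i) + 1) * (par V (xs ! j) + 1)))
            (fcomp V W p f (br (xs ! i) (xs ! j) # del i (del j xs))))"

text \<open>d_n f = d_n f_0 + d_n f_1 (linear extension from homogeneous cochains).\<close>
definition dcoch :: "(complex \<Rightarrow> 'm::ab_group_add \<Rightarrow> 'm) \<Rightarrow> (nat \<Rightarrow> 'g::zero set) \<Rightarrow> ('g \<Rightarrow> 'g \<Rightarrow> 'g)
    \<Rightarrow> (nat \<Rightarrow> 'm set) \<Rightarrow> ('g \<Rightarrow> 'm \<Rightarrow> 'm) \<Rightarrow> ('g list \<Rightarrow> 'm) \<Rightarrow> 'g list \<Rightarrow> 'm" where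
  "dcoch scm V br W act f xs = dpart scm V br W act 0 f xs + dpart scm V br W act 1 f xs"

text \<open>Chains C_n(g,M) = M (x) Sym^n(Pi g): an element is represented by a finite
  linear combination of generators alpha (x) x_1...x_n with homogeneous alpha, x_i,
  i.e. by a list of triples (c, alpha, [x_1,...,x_n]).\<close>
type_synonym ('m,'g) chain = "(complex \<times> 'm \<times> 'g list) list"

definition is_chain :: "(nat \<Rightarrow> 'g set) \<Rightarrow> (nat \<Rightarrow> 'm set) \<Rightarrow> nat \<Rightarrow> ('m,'g) chain \<Rightarrow> bool" where
  "is_chain V W n P \<longleftrightarrow> (\<forall>(c,a,xs)\<in>set P. homog W a \<and> length xs = n \<and> (\<forall>x\<in>set xs. homog V x))"

definition bd_gen :: "(nat \<Rightarrow> 'g::zero set) \<Rightarrow> ('g \<Rightarrow> 'g \<Rightarrow> 'g) \<Rightarrow> (nat \<Rightarrow> 'm::zero set) \<Rightarrow> ('g \<Rightarrow> 'm \<Rightarrow> 'm)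
    \<Rightarrow> 'm \<Rightarrow> 'g list \<Rightarrow> ('m,'g) chain" where
  "bd_gen V br W act a xs =
     map (\<lambda>i. (sgn ((par W a + kk V xs i) * (par V (xs ! i) + 1)), act (xs ! i) a, del i xs)) [0..<length xs]
   @ concat (map (\<lambda>j. map (\<lambda>i. (sgn (1 + par W a + (kk V xs i + 1) * (par V (xs ! i) + 1)
                                     + (kk V xs j + par V (xs ! i) + 1) * (par V (xs ! j) + 1)),
                               a, br (xs ! i) (xs ! j) # del i (del j xs))) [0..<j]) [0..<length xs])"

definition bd :: "(nat \<Rightarrow> 'g::zero set) \<Rightarrow> ('g \<Rightarrow> 'g \<Rightarrow> 'g) \<Rightarrow> (nat \<Rightarrow> 'm::zero set) \<Rightarrow> ('g \<Rightarrow> 'm \<Rightarrow> 'm)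
    \<Rightarrow> ('m,'g) chain \<Rightarrow> ('m,'g) chain" where
  "bd V br W act P = concat (map (\<lambda>(c,a,xs). map (\<lambda>(c',a',ys). (c * c', a', ys)) (bd_gen V br W act a xs)) P)"

definition Psi_n :: "(nat \<Rightarrow> 'b::zero set) \<Rightarrow> ('b \<Rightarrow> 'a) \<Rightarrow> ('m1 \<Rightarrow> 'm2 \<Rightarrow> complex)
    \<Rightarrow> ('a list \<Rightarrow> 'm1) \<Rightarrow> ('m2,'b) chain \<Rightarrow> complex" where
  "Psi_n V2 t psi f P = (\<Sum>(c,a,xs)\<leftarrow>P. c * sgn (\<Sum>x\<leftarrow>xs. par V2 x) * psi (f (rev (map t xs))) a)"

end

theory Submission
  imports Defs
begin

(*
  Both sides of the adjointness relation are linear in the chain, so it suffices to compare them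
  on a generator a (x) x_1...x_(n+1), where the cochain is evaluated at t x_(n+1) ... t x_1.
  This reversal matches the i-th action term of d f with the (n-i)-th action term of the boundary,
  and the (i,j)-th bracket term with the (n-j,n-i)-th one.  The action terms agree as soon as psi
  is invariant (P2): evenness of psi picks out the matching homogeneous component of f.  The
  bracket terms then agree when t is an anti-homomorphism (P1), after the bracket has been moved
  to the front of the argument list by supersymmetry of f.

  Conversely, testing the constant 0-cochain m on a (x) x gives (P2).  Given (P2), only the bracket
  terms survive when the 1-cochain z |-> phi(z) m is tested on a (x) x y.  With a homogeneous and
  psi(m,a) /= 0 this yields phi(t[x,y]) = phi([t y, t x]) for every linear functional phi, hence
  (P1).  All of this is done for homogeneous elements and extended by additivity.
*)

lemmas linear_map_add = module_hom.add[OF module_hom_linearI]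
  and linear_map_scale = module_hom.scale[OF module_hom_linearI]
  and linear_map_zero = module_hom.zero[OF module_hom_linearI]
  and linear_map_sum = module_hom.sum[OF module_hom_linearI]

lemma (in vector_space) linear_functionals_separate:
  assumes "\<And>\<phi>. Vector_Spaces.linear scale (*) \<phi> \<Longrightarrow> \<phi> u = \<phi> v"
  shows "u = v"
proof -
  obtain B where B: "independent B" "span B = UNIV"
    using basis_exists[of UNIV] by (metis top.extremum_uniqueI)
  have "representation B u = representation B v"
    using assms[OF linear_representation[OF B]] by auto
  then show ?thesis
    using sum_nonzero_representation_eq[OF B(1)] B(2) by (metis UNIV_I)
qed

lemma (in vector_space) linear_scale_by_functional:
  assumes "Vector_Spaces.linear s1 (*) \<phi>"
  shows "Vector_Spaces.linear s1 scale (\<lambda>z. scale (\<phi> z) v)"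
  using assms vector_space_axioms unfolding Vector_Spaces.linear_iff by (simp add: scale_left_distrib)

lemma sgn_cong: "(even a \<longleftrightarrow> even b) \<Longrightarrow> sgn a = sgn b"
  by (metis minus_one_power_iff)

section \<open>Super vector spaces\<close>

context
  fixes sc :: "complex \<Rightarrow> 'v::ab_group_add \<Rightarrow> 'v" and V :: "nat \<Rightarrow> 'v set"
  assumes super: "super_space sc V"
begin

lemma super_space_vector_space: "vector_space sc"
  using super by (simp add: super_space_def)

lemma super_space_subspace: "p < 2 \<Longrightarrow> module.subspace sc (V p)"
  using super by (auto simp: super_space_def less_2_cases_iff)

lemma zero_in_grade: "p < 2 \<Longrightarrow> 0 \<in> V p"
  using super_space_subspace super_space_vector_space module.subspace_0 module_iff_vector_space
  by metis

lemma super_space_decomp: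
  obtains a b where "a \<in> V 0" "b \<in> V 1" "v = a + b"
  using super unfolding super_space_def by (metis fst_conv snd_conv)

lemma super_space_decomp_unique:
  "a \<in> V 0 \<Longrightarrow> b \<in> V 1 \<Longrightarrow> a' \<in> V 0 \<Longrightarrow> b' \<in> V 1 \<Longrightarrow> a + b = a' + b' \<Longrightarrow> a = a' \<and> b = b'"
  using super unfolding super_space_def by (metis fst_conv snd_conv)

lemma par_eqI: "q < 2 \<Longrightarrow> x \<in> V q \<Longrightarrow> x \<noteq> 0 \<Longrightarrow> par V x = q"
  using super_space_decomp_unique[of x 0 0 x] zero_in_grade[of 0] zero_in_grade[of 1]
  by (auto simp: par_def less_2_cases_iff)

lemma in_grade_par: "homog V x \<Longrightarrow> x \<in> V (par V x)"
  using zero_in_grade[of 0] by (auto simp: homog_def par_def)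

lemma homogI: "q < 2 \<Longrightarrow> x \<in> V q \<Longrightarrow> homog V x"
  by (auto simp: homog_def less_2_cases_iff)

lemma proj_decomp:
  assumes a: "a \<in> V 0" and b: "b \<in> V 1"
  shows "proj V q (a + b) = (if q mod 2 = 0 then a else b)"
proof (cases "q mod 2 = 0")
  case True
  then have "Suc q mod 2 = 1"
    by presburger
  moreover have "(THE a'. a' \<in> V 0 \<and> a + b - a' \<in> V 1) = a"
  proof (rule the_equality)
    fix a' assume "a' \<in> V 0 \<and> a + b - a' \<in> V 1"
    moreover have "a' + (a + b - a') = a + b"
      by simp
    ultimately show "a' = a"
      using super_space_decomp_unique[OF _ _ a b] by blast
  qed (use a b in simp)
  ultimately show ?thesis
    using True by (simp add: proj_def)
next
  case False
  then have "q mod 2 = 1" "Suc q mod 2 = 0"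
    by presburger+
  moreover have "(THE b'. b' \<in> V 1 \<and> a + b - b' \<in> V 0) = b"
  proof (rule the_equality)
    fix b' assume "b' \<in> V 1 \<and> a + b - b' \<in> V 0"
    moreover have "(a + b - b') + b' = a + b"
      by simp
    ultimately show "b' = b"
      using super_space_decomp_unique[OF _ _ a b] by blast
  qed (use a b in simp)
  ultimately show ?thesis
    using False by (simp add: proj_def)
qed

lemma proj_in_grade: "r < 2 \<Longrightarrow> m \<in> V r \<Longrightarrow> proj V q m = (if q mod 2 = r then m else 0)"
  using proj_decomp[of m 0 q] proj_decomp[of 0 m q] zero_in_grade[of 0] zero_in_grade[of 1]
  by (auto simp: less_2_cases_iff)

lemma sum_proj_in_grade:
  fixes g :: "'v \<Rightarrow> 'a::semiring_0"
  assumes r: "r < 2" and m: "m \<in> V r" and g: "g 0 = 0"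
  shows "(\<Sum>p<2. s p * g (proj V p m)) = s r * g m"
proof -
  consider "r = 0" | "r = 1"
    using r by linarith
  then show ?thesis
    by cases (simp_all add: numeral_2_eq_2 proj_in_grade[OF r m] g)
qed

lemma proj_zero [simp]: "proj V q 0 = 0"
  using proj_in_grade[of 0 0 q] zero_in_grade[of 0] by simp

lemma additive_eq_if_eq_on_homog:
  assumes "\<And>x y. F (x + y) = F x + F y" and "\<And>x y. G (x + y) = G x + G y"
    and "\<And>x. homog V x \<Longrightarrow> F x = G x"
  shows "F x = G x"
proof -
  obtain a b where "a \<in> V 0" "b \<in> V 1" "x = a + b"
    using super_space_decomp .
  then show ?thesis
    using assms by (simp add: homog_def)
qed

end

lemma par_less_2: "par V x < 2"
  by (simp add: par_def)

lemma par_cases: "par V x = 0 \<or> par V x = 1"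
  by (simp add: par_def)

lemma bilinear_map_add_left:
  assumes "bilinear_map s1 s2 s3 b"
  shows "b (x + x') y = b x y + b x' y"
proof -
  from assms have "Vector_Spaces.linear s1 s3 (\<lambda>x. b x y)"
    by (simp add: bilinear_map_def)
  then show ?thesis
    by (rule linear_map_add)
qed

lemma bilinear_map_add_right:
  assumes "bilinear_map s1 s2 s3 b"
  shows "b x (y + y') = b x y + b x y'"
proof -
  from assms have "Vector_Spaces.linear s2 s3 (b x)"
    by (simp add: bilinear_map_def)
  then show ?thesis
    by (rule linear_map_add)
qed

lemma bilinear_map_zero_right:
  assumes "bilinear_map s1 s2 s3 b"
  shows "b x 0 = 0"
proof -
  from assms have "Vector_Spaces.linear s2 s3 (b x)"
    by (simp add: bilinear_map_def)
  then show ?thesis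
    by (rule linear_map_zero)
qed

lemma lie_superalgebra_bracket_grade:
  assumes g: "lie_superalgebra sc V br" and "homog V x" "homog V y"
  shows "br x y \<in> V ((par V x + par V y) mod 2)"
proof -
  have V: "super_space sc V"
    using g by (simp add: lie_superalgebra_def)
  have "\<forall>p q x y. p < 2 \<longrightarrow> q < 2 \<longrightarrow> x \<in> V p \<longrightarrow> y \<in> V q \<longrightarrow> br x y \<in> V ((p + q) mod 2)"
    using g unfolding lie_superalgebra_def by blast
  from this[rule_format, OF par_less_2 par_less_2 in_grade_par[OF V assms(2)] in_grade_par[OF V assms(3)]]
  show ?thesis .
qed

lemma lie_supermodule_action_grade:
  assumes M: "lie_supermodule sc V br scm W act" and V: "super_space sc V" and "homog V x" "homog W m"
  shows "act x m \<in> W ((par V x + par W m) mod 2)"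
proof -
  have W: "super_space scm W"
    using M by (simp add: lie_supermodule_def)
  have "\<forall>p q x m. p < 2 \<longrightarrow> q < 2 \<longrightarrow> x \<in> V p \<longrightarrow> m \<in> W q \<longrightarrow> act x m \<in> W ((p + q) mod 2)"
    using M unfolding lie_supermodule_def by blast
  from this[rule_format, OF par_less_2 par_less_2 in_grade_par[OF V assms(3)] in_grade_par[OF W assms(4)]]
  show ?thesis .
qed

definition par_sum :: "(nat \<Rightarrow> 'g::zero set) \<Rightarrow> 'g list \<Rightarrow> nat" where
  "par_sum V xs = (\<Sum>x\<leftarrow>xs. par V x)"

text \<open>Taken mod 2, the parity of \<open>x\<^sub>1\<cdots>x\<^sub>n\<close> in \<open>Sym(\<Pi>g)\<close>; \<^term>\<open>kk V xs i\<close> is the same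
  sum over the first \<open>i\<close> entries.\<close>

definition shifted_par_sum :: "(nat \<Rightarrow> 'g::zero set) \<Rightarrow> 'g list \<Rightarrow> nat" where
  "shifted_par_sum V xs = (\<Sum>x\<leftarrow>xs. par V x + 1)"

lemma par_sum_simps [simp]:
  "par_sum V [] = 0" "par_sum V (x # xs) = par V x + par_sum V xs"
  "par_sum V (xs @ ys) = par_sum V xs + par_sum V ys" "par_sum V (rev xs) = par_sum V xs"
  by (simp_all add: par_sum_def flip: rev_map)

lemma shifted_par_sum_simps [simp]:
  "shifted_par_sum V [] = 0" "shifted_par_sum V (x # xs) = par V x + 1 + shifted_par_sum V xs"
  "shifted_par_sum V (xs @ ys) = shifted_par_sum V xs + shifted_par_sum V ys"
  "shifted_par_sum V (rev xs) = shifted_par_sum V xs"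
  by (simp_all add: shifted_par_sum_def flip: rev_map)

lemma kk_eq_shifted_par_sum_take: "i \<le> length xs \<Longrightarrow> kk V xs i = shifted_par_sum V (take i xs)"
proof (induction i)
  case 0
  then show ?case
    by (simp add: kk_def)
next
  case (Suc i)
  then have "take (Suc i) xs = take i xs @ [xs ! i]"
    by (simp add: take_Suc_conv_app_nth)
  with Suc show ?case
    by (simp add: kk_def)
qed

lemma kk_length [simp]: "kk V xs (length xs) = shifted_par_sum V xs"
  by (simp add: kk_eq_shifted_par_sum_take)

lemma split_list_from_right:
  assumes "i < length xs"
  obtains A x C where "xs = A @ x # C" "length C = i"
proof
  let ?k = "length xs - Suc i"
  show "xs = take ?k xs @ xs ! ?k # drop (Suc ?k) xs"
    using assms by (simp add: id_take_nth_drop)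
  show "length (drop (Suc ?k) xs) = i"
    using assms by simp
qed

lemma split_list_from_right2:
  assumes "i < j" "j < length xs"
  obtains A x M x' C where "xs = A @ x # M @ x' # C" "length C = i" "length M + Suc i = j"
proof -
  obtain A x R where xs: "xs = A @ x # R" and R: "length R = j"
    using split_list_from_right[OF assms(2)] .
  obtain M x' C where "R = M @ x' # C" "length C = i"
    using split_list_from_right[of i R] assms(1) R by auto
  with xs R that show ?thesis
    by simp
qed

section \<open>Cochains\<close>

context
  fixes sc :: "complex \<Rightarrow> 'g::ab_group_add \<Rightarrow> 'g" and V :: "nat \<Rightarrow> 'g set"
    and scm :: "complex \<Rightarrow> 'm::ab_group_add \<Rightarrow> 'm" and n :: nat and f :: "'g list \<Rightarrow> 'm"
  assumes cochain: "cochain sc V scm n f"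
begin

lemma cochain_zero:
  assumes "length zs = n" and "0 \<in> set zs"
  shows "f zs = 0"
proof -
  obtain i where i: "i < length zs" "zs ! i = 0"
    using assms(2) by (auto simp: in_set_conv_nth)
  then have "Vector_Spaces.linear sc scm (\<lambda>y. f (zs[i := y]))"
    using cochain assms(1) by (simp add: cochain_def)
  then have "f (zs[i := 0]) = 0"
    using linear_map_zero by fastforce
  with i show ?thesis
    by (metis list_update_id)
qed

lemma cochain_swap:
  assumes "length (A @ z # w # B) = n" and "homog V z" and "homog V w"
  shows "f (A @ w # z # B) = scm (sgn ((par V z + 1) * (par V w + 1))) (f (A @ z # w # B))"
proof -
  let ?xs = "A @ z # w # B" and ?i = "length A"
  have "?xs[?i := ?xs ! Suc ?i, Suc ?i := ?xs ! ?i] = A @ w # z # B"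
    by (simp add: list_update_append nth_append)
  moreover have "?xs ! ?i = z" "?xs ! Suc ?i = w"
    by (simp_all add: nth_append)
  ultimately show ?thesis
    using cochain assms unfolding cochain_def by (metis length_append length_Cons add_Suc_right less_add_Suc1 add_Suc_shift)
qed

lemma cochain_move_to_end:
  assumes scm: "vector_space scm"
  shows "length (A @ z # R) = n \<Longrightarrow> homog V z \<Longrightarrow> \<forall>w\<in>set R. homog V w \<Longrightarrow>
    f (A @ z # R) = scm (sgn ((par V z + 1) * shifted_par_sum V R)) (f (A @ R @ [z]))"
proof (induction R arbitrary: A)
  case Nil
  then show ?case
    using scm by (simp add: vector_space_def)
next
  case (Cons w R)
  have "f (A @ z # w # R) = scm (sgn ((par V w + 1) * (par V z + 1))) (f ((A @ [w]) @ z # R))"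
    using cochain_swap[of A w z R] Cons.prems by simp
  also have "\<dots> = scm (sgn ((par V w + 1) * (par V z + 1)))
      (scm (sgn ((par V z + 1) * shifted_par_sum V R)) (f (A @ w # R @ [z])))"
    using Cons.IH[of "A @ [w]"] Cons.prems by simp
  also have "\<dots> = scm (sgn ((par V z + 1) * shifted_par_sum V (w # R))) (f (A @ (w # R) @ [z]))"
    using scm by (simp add: vector_space_def power_add algebra_simps)
  finally show ?case .
qed

end

lemma cochain_degree_one:
  assumes "Vector_Spaces.linear sc scm g"
  shows "cochain sc V scm 1 (\<lambda>zs. g (hd zs))"
  unfolding cochain_def
proof (intro conjI allI impI)
  fix xs :: "'a list" and i :: nat
  assume "length xs = 1" "i < 1"
  then obtain z where "xs = [z]" "i = 0"
    by (auto simp: length_Suc_conv)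
  then show "Vector_Spaces.linear sc scm (\<lambda>y. g (hd (xs[i := y])))"
    using assms by simp
qed simp

section \<open>The pairing of cochains with chains\<close>

lemma Psi_n_Nil [simp]: "Psi_n V t psi f [] = 0"
  by (simp add: Psi_n_def)

lemma Psi_n_Cons [simp]:
  "Psi_n V t psi f ((c, a, xs) # P) = c * sgn (par_sum V xs) * psi (f (rev (map t xs))) a + Psi_n V t psi f P"
  by (simp add: Psi_n_def par_sum_def)

lemma Psi_n_append [simp]: "Psi_n V t psi f (P @ Q) = Psi_n V t psi f P + Psi_n V t psi f Q"
  by (simp add: Psi_n_def)

lemma Psi_n_concat: "Psi_n V t psi f (concat L) = (\<Sum>P\<leftarrow>L. Psi_n V t psi f P)"
  by (induction L) simp_all

lemma Psi_n_scale: "Psi_n V t psi f (map (\<lambda>(c', y). (c * c', y)) P) = c * Psi_n V t psi f P"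
  by (induction P) (auto simp: algebra_simps)

lemma Psi_n_bd:
  "Psi_n V t psi f (bd V br W act P) = (\<Sum>(c, a, xs)\<leftarrow>P. c * Psi_n V t psi f (bd_gen V br W act a xs))"
  by (induction P) (auto simp: bd_def Psi_n_scale)

lemma sum_lessThan_pairs:
  "(\<Sum>l<(N::nat). \<Sum>k<l. g k l) = (\<Sum>(k, l)\<in>{(k, l). k < l \<and> l < N}. g k l)"
proof -
  have "(\<Sum>l<N. \<Sum>k<l. g k l) = (\<Sum>(l, k)\<in>(SIGMA l:{..<N}. {..<l}). g k l)"
    using sum.Sigma[of "{..<N}" "\<lambda>l. {..<l}" "\<lambda>l k. g k l"] by simp
  also have "\<dots> = (\<Sum>(k, l)\<in>{(k, l). k < l \<and> l < N}. g k l)"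
    by (rule sum.reindex_bij_witness[of _ "\<lambda>(k, l). (l, k)" "\<lambda>(l, k). (k, l)"]) auto
  finally show ?thesis .
qed

locale dual_complexes =
  fixes sc1 :: "complex \<Rightarrow> 'g1::ab_group_add \<Rightarrow> 'g1" and V1 :: "nat \<Rightarrow> 'g1 set" and br1 :: "'g1 \<Rightarrow> 'g1 \<Rightarrow> 'g1"
    and sc2 :: "complex \<Rightarrow> 'g2::ab_group_add \<Rightarrow> 'g2" and V2 :: "nat \<Rightarrow> 'g2 set" and br2 :: "'g2 \<Rightarrow> 'g2 \<Rightarrow> 'g2"
    and scm1 :: "complex \<Rightarrow> 'm1::ab_group_add \<Rightarrow> 'm1" and W1 :: "nat \<Rightarrow> 'm1 set" and act1 :: "'g1 \<Rightarrow> 'm1 \<Rightarrow> 'm1"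
    and scm2 :: "complex \<Rightarrow> 'm2::ab_group_add \<Rightarrow> 'm2" and W2 :: "nat \<Rightarrow> 'm2 set" and act2 :: "'g2 \<Rightarrow> 'm2 \<Rightarrow> 'm2"
    and t :: "'g2 \<Rightarrow> 'g1" and psi :: "'m1 \<Rightarrow> 'm2 \<Rightarrow> complex"
  assumes g1: "lie_superalgebra sc1 V1 br1" and g2: "lie_superalgebra sc2 V2 br2"
    and M1: "lie_supermodule sc1 V1 br1 scm1 W1 act1" and M2: "lie_supermodule sc2 V2 br2 scm2 W2 act2"
    and t_iso: "even_linear_iso sc2 V2 sc1 V1 t"
    and pairing: "nondeg_even_pairing scm1 W1 scm2 W2 psi"
begin

lemma V1_super: "super_space sc1 V1"
  using g1 by (simp add: lie_superalgebra_def)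

lemma V2_super: "super_space sc2 V2"
  using g2 by (simp add: lie_superalgebra_def)

lemma W1_super: "super_space scm1 W1"
  using M1 by (simp add: lie_supermodule_def)

lemma W2_super: "super_space scm2 W2"
  using M2 by (simp add: lie_supermodule_def)

lemma t_linear: "Vector_Spaces.linear sc2 sc1 t"
  using t_iso by (simp add: even_linear_iso_def)

lemma t_bij: "bij t"
  using t_iso by (simp add: even_linear_iso_def)

lemma t_grade: "p < 2 \<Longrightarrow> x \<in> V2 p \<Longrightarrow> t x \<in> V1 p"
  using t_iso by (auto simp: even_linear_iso_def)

lemma t_zero [simp]: "t 0 = 0"
  using linear_map_zero[OF t_linear] .

lemma t_eq_0_iff: "t x = 0 \<longleftrightarrow> x = 0"
  using t_bij t_zero by (metis bij_pointE)

lemma par_t [simp]: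
  assumes "homog V2 x"
  shows "par V1 (t x) = par V2 x"
proof (cases "x = 0")
  case False
  have "t x \<in> V1 (par V2 x)"
    using t_grade[OF par_less_2 in_grade_par[OF V2_super assms]] .
  with False show ?thesis
    using par_eqI[OF V1_super par_less_2[of V2 x]] t_eq_0_iff by simp
qed (simp add: par_def)

lemma homog_t: "homog V2 x \<Longrightarrow> homog V1 (t x)"
  using homogI[OF V1_super par_less_2 t_grade[OF par_less_2 in_grade_par[OF V2_super]]] .

lemma shifted_par_sum_map_t [simp]:
  "\<forall>x\<in>set xs. homog V2 x \<Longrightarrow> shifted_par_sum V1 (map t xs) = shifted_par_sum V2 xs"
  by (induction xs) auto

lemma t_add: "t (x + y) = t x + t y"
  using linear_map_add[OF t_linear] .

lemma br1_bilinear: "bilinear_map sc1 sc1 sc1 br1"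
  using g1 by (simp add: lie_superalgebra_def)

lemma br2_bilinear: "bilinear_map sc2 sc2 sc2 br2"
  using g2 by (simp add: lie_superalgebra_def)

lemma act1_bilinear: "bilinear_map sc1 scm1 scm1 act1"
  using M1 by (simp add: lie_supermodule_def)

lemma act2_bilinear: "bilinear_map sc2 scm2 scm2 act2"
  using M2 by (simp add: lie_supermodule_def)

lemma psi_bilinear: "bilinear_map scm1 scm2 (*) psi"
  using pairing by (simp add: nondeg_even_pairing_def)

lemma psi_linear_left: "Vector_Spaces.linear scm1 (*) (\<lambda>m. psi m b)"
  using psi_bilinear by (simp add: bilinear_map_def)

lemmas psi_add_left = bilinear_map_add_left[OF psi_bilinear]
  and psi_add_right = bilinear_map_add_right[OF psi_bilinear]

lemma psi_scale_left: "psi (scm1 c m) b = c * psi m b"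
  using linear_map_scale[OF psi_linear_left] by simp

lemma psi_zero_left [simp]: "psi 0 b = 0"
  using linear_map_zero[OF psi_linear_left] .

lemma psi_sum_left: "psi (sum g A) b = (\<Sum>x\<in>A. psi (g x) b)"
  using linear_map_sum[OF psi_linear_left] .

lemma psi_grade_mismatch: "p < 2 \<Longrightarrow> q < 2 \<Longrightarrow> p \<noteq> q \<Longrightarrow> m \<in> W1 p \<Longrightarrow> b \<in> W2 q \<Longrightarrow> psi m b = 0"
  using pairing by (simp add: nondeg_even_pairing_def)

lemma psi_nondegenerate_left: "(\<And>b. psi m b = 0) \<Longrightarrow> m = 0"
  using pairing by (simp add: nondeg_even_pairing_def)

lemmas br1_grade = lie_superalgebra_bracket_grade[OF g1]
  and br2_grade = lie_superalgebra_bracket_grade[OF g2]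
  and act1_grade = lie_supermodule_action_grade[OF M1 V1_super]
  and act2_grade = lie_supermodule_action_grade[OF M2 V2_super]

lemma psi_proj:
  assumes r: "r < 2" and b: "b \<in> W2 r"
  shows "psi (proj W1 q m) b = (if q mod 2 = r then psi m b else 0)"
proof -
  obtain m0 m1 where m: "m0 \<in> W1 0" "m1 \<in> W1 1" "m = m0 + m1"
    using super_space_decomp[OF W1_super] .
  have proj: "proj W1 q m = (if q mod 2 = 0 then m0 else m1)"
    using proj_decomp[OF W1_super m(1,2)] m(3) by simp
  have psi_m: "psi m b = psi m0 b + psi m1 b"
    using m(3) psi_add_left by simp
  consider "r = 0" | "r = 1"
    using r by linarith
  then show ?thesis
  proof cases
    case 1
    then have "psi m1 b = 0"
      using psi_grade_mismatch[of 1 r m1 b] m b by simp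
    with 1 proj psi_m show ?thesis
      by simp
  next
    case 2
    then have "psi m0 b = 0"
      using psi_grade_mismatch[of 0 r m0 b] m b by simp
    with 2 proj psi_m show ?thesis
      by auto
  qed
qed

text \<open>Pairing with a homogeneous element sees a single homogeneous component; this collapses the
  sum over the two parity components of a cochain in \<^const>\<open>dcoch\<close>.\<close>

lemma psi_proj_select:
  assumes r: "r < 2" and b: "b \<in> W2 r"
  shows "(\<Sum>p<2. s p * psi (proj W1 (p + K) m) b) = s ((r + K) mod 2) * psi m b"
proof -
  have "(\<Sum>p<2. s p * psi (proj W1 (p + K) m) b) = s 0 * psi (proj W1 K m) b + s 1 * psi (proj W1 (Suc K) m) b"
    by (simp add: numeral_2_eq_2)
  moreover have "K mod 2 = r \<longleftrightarrow> (r + K) mod 2 = 0" "Suc K mod 2 = r \<longleftrightarrow> (r + K) mod 2 = 1"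
    using r by presburger+
  moreover have "K mod 2 = r \<longleftrightarrow> Suc K mod 2 \<noteq> r"
    using r by presburger
  ultimately show ?thesis
    by (auto simp: psi_proj[OF r b])
qed

lemma invariance_if_invariant_on_homog:
  assumes "\<And>x m a. homog V2 x \<Longrightarrow> homog W1 m \<Longrightarrow> homog W2 a \<Longrightarrow> psi m (act2 x a) = psi (act1 (t x) m) a"
  shows "psi m (act2 x a) = psi (act1 (t x) m) a"
proof -
  have in_a: "psi m (act2 x a) = psi (act1 (t x) m) a" if "homog V2 x" "homog W1 m" for x m a
    by (rule additive_eq_if_eq_on_homog[OF W2_super])
      (use assms that in \<open>simp_all add: bilinear_map_add_right[OF act2_bilinear] psi_add_right\<close>)
  have in_m: "psi m (act2 x a) = psi (act1 (t x) m) a" if "homog V2 x" for x m a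
    by (rule additive_eq_if_eq_on_homog[OF W1_super, where F = "\<lambda>m. psi m (act2 x a)"])
      (use in_a that in \<open>simp_all add: bilinear_map_add_right[OF act1_bilinear] psi_add_left\<close>)
  show ?thesis
    by (rule additive_eq_if_eq_on_homog[OF V2_super, where F = "\<lambda>x. psi m (act2 x a)"])
      (use in_m in \<open>simp_all add: bilinear_map_add_left[OF act1_bilinear] bilinear_map_add_left[OF act2_bilinear] t_add psi_add_left psi_add_right\<close>)
qed

lemma anti_if_anti_on_homog:
  assumes "\<And>x y. homog V2 x \<Longrightarrow> homog V2 y \<Longrightarrow> t (br2 x y) = br1 (t y) (t x)"
  shows "t (br2 x y) = br1 (t y) (t x)"
proof -
  have in_y: "t (br2 x y) = br1 (t y) (t x)" if "homog V2 x" for x y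
    by (rule additive_eq_if_eq_on_homog[OF V2_super])
      (use assms that in \<open>simp_all add: bilinear_map_add_right[OF br2_bilinear] bilinear_map_add_left[OF br1_bilinear] t_add\<close>)
  show ?thesis
    by (rule additive_eq_if_eq_on_homog[OF V2_super, where F = "\<lambda>x. t (br2 x y)"])
      (use in_y in \<open>simp_all add: bilinear_map_add_left[OF br2_bilinear] bilinear_map_add_right[OF br1_bilinear] t_add\<close>)
qed

lemma exists_pairing_nonzero_homog:
  assumes "\<exists>m::'m1. m \<noteq> 0"
  obtains m a where "homog W2 a" "psi m a \<noteq> 0"
proof -
  obtain m :: 'm1 where "m \<noteq> 0"
    using assms by blast
  then obtain b where b: "psi m b \<noteq> 0"
    using psi_nondegenerate_left by blast
  obtain b0 b1 where bb: "b0 \<in> W2 0" "b1 \<in> W2 1" "b = b0 + b1"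
    using super_space_decomp[OF W2_super] .
  with b have "psi m b0 \<noteq> 0 \<or> psi m b1 \<noteq> 0"
    by (auto simp: psi_add_right)
  with bb that show ?thesis
    unfolding homog_def by blast
qed

text \<open>The summands of \<^term>\<open>psi (dcoch scm1 V1 br1 W1 act1 f ys) a\<close> (for the parity \<open>p\<close>
  component of \<open>f\<close>) and of \<^term>\<open>Psi_n V2 t psi f (bd_gen V2 br2 W2 act2 a xs)\<close>.\<close>

definition d_act_term :: "nat \<Rightarrow> ('g1 list \<Rightarrow> 'm1) \<Rightarrow> 'g1 list \<Rightarrow> 'm2 \<Rightarrow> nat \<Rightarrow> complex" where
  "d_act_term p f ys a i = sgn (par V1 (ys ! i) + (p + kk V1 ys i) * (par V1 (ys ! i) + 1))
     * psi (act1 (ys ! i) (fcomp V1 W1 p f (del i ys))) a"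

definition d_bracket_term :: "nat \<Rightarrow> ('g1 list \<Rightarrow> 'm1) \<Rightarrow> 'g1 list \<Rightarrow> 'm2 \<Rightarrow> nat \<Rightarrow> nat \<Rightarrow> complex" where
  "d_bracket_term p f ys a i j =
     sgn (p + (kk V1 ys i + 1) * (par V1 (ys ! i) + 1) + (kk V1 ys j + par V1 (ys ! i) + 1) * (par V1 (ys ! j) + 1))
     * psi (fcomp V1 W1 p f (br1 (ys ! i) (ys ! j) # del i (del j ys))) a"

definition bd_act_term :: "('g1 list \<Rightarrow> 'm1) \<Rightarrow> 'm2 \<Rightarrow> 'g2 list \<Rightarrow> nat \<Rightarrow> complex" where
  "bd_act_term f a xs k = sgn ((par W2 a + kk V2 xs k) * (par V2 (xs ! k) + 1)) * sgn (par_sum V2 (del k xs))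
     * psi (f (rev (map t (del k xs)))) (act2 (xs ! k) a)"

definition bd_bracket_term :: "('g1 list \<Rightarrow> 'm1) \<Rightarrow> 'm2 \<Rightarrow> 'g2 list \<Rightarrow> nat \<Rightarrow> nat \<Rightarrow> complex" where
  "bd_bracket_term f a xs k l =
     sgn (1 + par W2 a + (kk V2 xs k + 1) * (par V2 (xs ! k) + 1) + (kk V2 xs l + par V2 (xs ! k) + 1) * (par V2 (xs ! l) + 1))
     * sgn (par_sum V2 (br2 (xs ! k) (xs ! l) # del k (del l xs)))
     * psi (f (rev (map t (br2 (xs ! k) (xs ! l) # del k (del l xs))))) a"

lemma psi_dcoch:
  "psi (dcoch scm1 V1 br1 W1 act1 f ys) a =
     (\<Sum>p<2. \<Sum>i<length ys. d_act_term p f ys a i)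
   + (\<Sum>p<2. \<Sum>(i, j)\<in>{(i, j). i < j \<and> j < length ys}. d_bracket_term p f ys a i j)"
proof -
  have "psi (dpart scm1 V1 br1 W1 act1 p f ys) a =
      (\<Sum>i<length ys. d_act_term p f ys a i)
    + (\<Sum>(i, j)\<in>{(i, j). i < j \<and> j < length ys}. d_bracket_term p f ys a i j)" for p
    unfolding dpart_def psi_add_left psi_sum_left d_act_term_def d_bracket_term_def
    by (intro arg_cong2[where f = "(+)"] sum.cong) (auto simp: psi_scale_left)
  then show ?thesis
    by (simp add: dcoch_def psi_add_left numeral_2_eq_2)
qed

lemma Psi_n_bd_gen:
  "Psi_n V2 t psi f (bd_gen V2 br2 W2 act2 a xs) =
     (\<Sum>k<length xs. bd_act_term f a xs k)
   + (\<Sum>(k, l)\<in>{(k, l). k < l \<and> l < length xs}. bd_bracket_term f a xs k l)"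
  unfolding bd_gen_def Psi_n_append Psi_n_concat sum_lessThan_pairs[symmetric]
  by (simp add: Psi_n_def par_sum_def bd_act_term_def bd_bracket_term_def interv_sum_list_conv_sum_set_nat
      atLeast0LessThan comp_def)

definition adjoint_on_generators :: "nat \<Rightarrow> ('g1 list \<Rightarrow> 'm1) \<Rightarrow> bool" where
  "adjoint_on_generators n f \<longleftrightarrow> (\<forall>a xs. homog W2 a \<longrightarrow> length xs = Suc n \<longrightarrow> (\<forall>x\<in>set xs. homog V2 x) \<longrightarrow>
     sgn (par_sum V2 xs) * psi (dcoch scm1 V1 br1 W1 act1 f (rev (map t xs))) a
       = Psi_n V2 t psi f (bd_gen V2 br2 W2 act2 a xs))"

lemma adjoint_iff_adjoint_on_generators:
  "(\<forall>P. is_chain V2 W2 (Suc n) P \<longrightarrow>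
      Psi_n V2 t psi (dcoch scm1 V1 br1 W1 act1 f) P = Psi_n V2 t psi f (bd V2 br2 W2 act2 P))
   \<longleftrightarrow> adjoint_on_generators n f"
proof
  assume adjoint: "\<forall>P. is_chain V2 W2 (Suc n) P \<longrightarrow>
      Psi_n V2 t psi (dcoch scm1 V1 br1 W1 act1 f) P = Psi_n V2 t psi f (bd V2 br2 W2 act2 P)"
  show "adjoint_on_generators n f"
    unfolding adjoint_on_generators_def
  proof (intro allI impI)
    fix a xs
    assume "homog W2 a" "length xs = Suc n" "\<forall>x\<in>set xs. homog V2 x"
    then have "is_chain V2 W2 (Suc n) [(1, a, xs)]"
      by (simp add: is_chain_def)
    from adjoint[rule_format, OF this] show "sgn (par_sum V2 xs) * psi (dcoch scm1 V1 br1 W1 act1 f (rev (map t xs))) a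
        = Psi_n V2 t psi f (bd_gen V2 br2 W2 act2 a xs)"
      by (simp add: Psi_n_bd)
  qed
next
  assume generators: "adjoint_on_generators n f"
  show "\<forall>P. is_chain V2 W2 (Suc n) P \<longrightarrow>
      Psi_n V2 t psi (dcoch scm1 V1 br1 W1 act1 f) P = Psi_n V2 t psi f (bd V2 br2 W2 act2 P)"
  proof (intro allI impI)
    fix P
    show "is_chain V2 W2 (Suc n) P \<Longrightarrow>
        Psi_n V2 t psi (dcoch scm1 V1 br1 W1 act1 f) P = Psi_n V2 t psi f (bd V2 br2 W2 act2 P)"
    proof (induction P)
      case (Cons g P)
      obtain c a xs where g: "g = (c, a, xs)"
        by (cases g) auto
      with Cons.prems have "homog W2 a" "length xs = Suc n" "\<forall>x\<in>set xs. homog V2 x" "is_chain V2 W2 (Suc n) P"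
        by (auto simp: is_chain_def)
      with Cons.IH generators show ?case
        unfolding g adjoint_on_generators_def by (simp add: Psi_n_bd mult.assoc)
    qed (simp add: Psi_n_bd)
  qed
qed

lemma invariance_if_adjoint_degree_zero:
  assumes adjoint: "\<And>f. cochain sc1 V1 scm1 0 f \<Longrightarrow> adjoint_on_generators 0 f"
    and hm: "homog W1 m" and hx: "homog V2 x" and ha: "homog W2 a"
  shows "psi m (act2 x a) = psi (act1 (t x) m) a"
proof -
  have no_pairs: "{(i, j). i < j \<and> j = (0::nat)} = {}"
    by auto
  have "cochain sc1 V1 scm1 0 (\<lambda>_. m)"
    by (simp add: cochain_def)
  note adjoint = adjoint[OF this]
  have "sgn (par V2 x) * (\<Sum>p<2. sgn (par V2 x + p * (par V2 x + 1)) * psi (act1 (t x) (proj W1 p m)) a)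
      = sgn (par W2 a * (par V2 x + 1)) * psi m (act2 x a)"
    using adjoint[unfolded adjoint_on_generators_def, rule_format, of a "[x]"] hx ha
    by (simp add: no_pairs psi_dcoch Psi_n_bd_gen d_act_term_def bd_act_term_def fcomp_def kk_def del_def)
  moreover have "(\<Sum>p<2. sgn (par V2 x + p * (par V2 x + 1)) * psi (act1 (t x) (proj W1 p m)) a)
      = sgn (par V2 x + par W1 m * (par V2 x + 1)) * psi (act1 (t x) m) a"
    by (rule sum_proj_in_grade[OF W1_super par_less_2 in_grade_par[OF W1_super hm]])
      (simp add: bilinear_map_zero_right[OF act1_bilinear])
  ultimately have eq: "sgn (par V2 x) * sgn (par V2 x + par W1 m * (par V2 x + 1)) * psi (act1 (t x) m) a
      = sgn (par W2 a * (par V2 x + 1)) * psi m (act2 x a)"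
    by (simp add: mult.assoc)
  show ?thesis
  proof (cases "par W1 m = (par V2 x + par W2 a) mod 2")
    case True
    then have "sgn (par V2 x) * sgn (par V2 x + par W1 m * (par V2 x + 1)) = sgn (par W2 a * (par V2 x + 1))"
      unfolding power_add[symmetric] using par_cases[of V2 x] par_cases[of W2 a] by (intro sgn_cong) auto
    with eq show ?thesis
      by simp
  next
    case False
    have "psi m (act2 x a) = 0"
      using psi_grade_mismatch[OF par_less_2 _ False in_grade_par[OF W1_super hm] act2_grade[OF hx ha]] by simp
    moreover have "psi (act1 (t x) m) a = 0"
    proof (rule psi_grade_mismatch[OF _ par_less_2 _ _ in_grade_par[OF W2_super ha]])
      show "act1 (t x) m \<in> W1 ((par V2 x + par W1 m) mod 2)"
        using act1_grade[OF homog_t[OF hx] hm] hx by simp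
      show "(par V2 x + par W1 m) mod 2 \<noteq> par W2 a"
        using False par_cases[of V2 x] par_cases[of W1 m] par_cases[of W2 a] by auto
    qed simp
    ultimately show ?thesis
      by simp
  qed
qed

lemma sum_d_bracket_term_split:
  assumes anti: "\<And>x y. t (br2 x y) = br1 (t y) (t x)"
    and f: "cochain sc1 V1 scm1 n f" and len: "length (A @ x # M @ x' # C) = Suc n"
    and hA: "\<forall>y\<in>set A. homog V2 y" and hx: "homog V2 x" and hM: "\<forall>y\<in>set M. homog V2 y"
    and hx': "homog V2 x'" and hC: "\<forall>y\<in>set C. homog V2 y" and ha: "homog W2 a"
  shows "(\<Sum>p<2. d_bracket_term p f (rev (map t (A @ x # M @ x' # C))) a (length C) (length M + Suc (length C)))
    = sgn ((par W2 a + (par V2 (br2 x x') + 1 + shifted_par_sum V2 (A @ M @ C))) mod 2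
        + (shifted_par_sum V2 C + 1) * (par V2 x' + 1)
        + (shifted_par_sum V2 C + par V2 x' + 1 + shifted_par_sum V2 M + par V2 x' + 1) * (par V2 x + 1))
      * sgn ((par V2 (br2 x x') + 1) * shifted_par_sum V2 (A @ M @ C))
      * psi (f (rev (map t (br2 x x' # A @ M @ C)))) a"
proof -
  let ?b = "br2 x x'" and ?D = "A @ M @ C"
  let ?K = "par V2 ?b + 1 + shifted_par_sum V2 ?D"
  let ?E = "\<lambda>p. p + (shifted_par_sum V2 C + 1) * (par V2 x' + 1)
    + (shifted_par_sum V2 C + par V2 x' + 1 + shifted_par_sum V2 M + par V2 x' + 1) * (par V2 x + 1)"
  have hb: "homog V2 ?b"
    using homogI[OF V2_super _ br2_grade[OF hx hx']] by simp
  have hD: "\<forall>y\<in>set ?D. homog V2 y"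
    using hA hM hC by auto
  have move: "f (t ?b # rev (map t D)) = scm1 (sgn ((par V2 ?b + 1) * shifted_par_sum V2 D)) (f (rev (map t (?b # D))))"
    if "\<forall>y\<in>set D. homog V2 y" and "length D = length ?D" for D
    using cochain_move_to_end[OF f super_space_vector_space[OF W1_super], of "[]" "t ?b" "rev (map t D)"]
      that len hb homog_t by simp
  have "d_bracket_term p f (rev (map t (A @ x # M @ x' # C))) a (length C) (length M + Suc (length C))
      = sgn (?E p) * psi (proj W1 (p + ?K) (f (t ?b # rev (map t ?D)))) a" for p
    using hA hM hC hx hx' hb
    by (simp add: d_bracket_term_def fcomp_def kk_eq_shifted_par_sum_take nth_append del_def anti[symmetric]
        ac_simps)
  then have "(\<Sum>p<2. d_bracket_term p f (rev (map t (A @ x # M @ x' # C))) a (length C) (length M + Suc (length C)))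
      = (\<Sum>p<2. sgn (?E p) * psi (proj W1 (p + ?K) (f (t ?b # rev (map t ?D)))) a)"
    by simp
  also have "\<dots> = sgn (?E ((par W2 a + ?K) mod 2)) * psi (f (t ?b # rev (map t ?D))) a"
    by (rule psi_proj_select[OF par_less_2 in_grade_par[OF W2_super ha]])
  finally show ?thesis
    by (simp only: move[OF hD refl] psi_scale_left mult.assoc)
qed

lemma bd_bracket_term_split:
  "bd_bracket_term f a (A @ x # M @ x' # C) (length A) (length A + Suc (length M))
    = sgn (1 + par W2 a + (shifted_par_sum V2 A + 1) * (par V2 x + 1)
        + (shifted_par_sum V2 A + par V2 x + 1 + shifted_par_sum V2 M + par V2 x + 1) * (par V2 x' + 1))
      * sgn (par V2 (br2 x x') + par_sum V2 (A @ M @ C))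
      * psi (f (rev (map t (br2 x x' # A @ M @ C)))) a"
  by (simp add: bd_bracket_term_def kk_eq_shifted_par_sum_take nth_append del_def ac_simps)

lemma bracket_terms_match:
  assumes "\<And>x y. t (br2 x y) = br1 (t y) (t x)"
    and f: "cochain sc1 V1 scm1 n f" and len: "length (A @ x # M @ x' # C) = Suc n"
    and "\<forall>y\<in>set A. homog V2 y" and hx: "homog V2 x" and "\<forall>y\<in>set M. homog V2 y"
    and hx': "homog V2 x'" and "\<forall>y\<in>set C. homog V2 y" and "homog W2 a"
  shows "sgn (par_sum V2 (A @ x # M @ x' # C)) *
      (\<Sum>p<2. d_bracket_term p f (rev (map t (A @ x # M @ x' # C))) a (length C) (length M + Suc (length C)))
    = bd_bracket_term f a (A @ x # M @ x' # C) (length A) (length A + Suc (length M))"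
proof (cases "br2 x x' = 0")
  \<comment> \<open>\<open>par V 0 = 0\<close> whatever the grade, so a vanishing bracket is treated apart\<close>
  case True
  then have "f (rev (map t (br2 x x' # A @ M @ C))) = 0"
    using cochain_zero[OF f] len by simp
  then show ?thesis
    unfolding sum_d_bracket_term_split[OF assms] bd_bracket_term_split by simp
next
  case False
  then have "par V2 (br2 x x') = (par V2 x + par V2 x') mod 2"
    using par_eqI[OF V2_super _ br2_grade[OF hx hx']] by simp
  then have "sgn (par_sum V2 (A @ x # M @ x' # C))
      * sgn ((par W2 a + (par V2 (br2 x x') + 1 + shifted_par_sum V2 (A @ M @ C))) mod 2
        + (shifted_par_sum V2 C + 1) * (par V2 x' + 1)
        + (shifted_par_sum V2 C + par V2 x' + 1 + shifted_par_sum V2 M + par V2 x' + 1) * (par V2 x + 1))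
      * sgn ((par V2 (br2 x x') + 1) * shifted_par_sum V2 (A @ M @ C))
    = sgn (1 + par W2 a + (shifted_par_sum V2 A + 1) * (par V2 x + 1)
        + (shifted_par_sum V2 A + par V2 x + 1 + shifted_par_sum V2 M + par V2 x + 1) * (par V2 x' + 1))
      * sgn (par V2 (br2 x x') + par_sum V2 (A @ M @ C))"
    unfolding power_add[symmetric] by (intro sgn_cong) (simp; argo)
  then show ?thesis
    unfolding sum_d_bracket_term_split[OF assms] bd_bracket_term_split by (simp only: mult.assoc[symmetric])
qed

lemma sum_bracket_terms_match:
  assumes anti: "\<And>x y. t (br2 x y) = br1 (t y) (t x)"
    and f: "cochain sc1 V1 scm1 n f" and len: "length xs = Suc n"
    and hxs: "\<forall>x\<in>set xs. homog V2 x" and ha: "homog W2 a"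
  shows "sgn (par_sum V2 xs) *
      (\<Sum>p<2. \<Sum>(i, j)\<in>{(i, j). i < j \<and> j < length xs}. d_bracket_term p f (rev (map t xs)) a i j)
    = (\<Sum>(k, l)\<in>{(k, l). k < l \<and> l < length xs}. bd_bracket_term f a xs k l)"
proof -
  let ?pairs = "{(i, j). i < j \<and> j < length xs}" and ?N = "length xs"
  have "sgn (par_sum V2 xs) * (\<Sum>p<2. \<Sum>(i, j)\<in>?pairs. d_bracket_term p f (rev (map t xs)) a i j)
      = (\<Sum>(i, j)\<in>?pairs. sgn (par_sum V2 xs) * (\<Sum>p<2. d_bracket_term p f (rev (map t xs)) a i j))"
    by (simp add: sum.swap[of _ "{..<2}"] sum_distrib_left split_def)
  also have "\<dots> = (\<Sum>(k, l)\<in>?pairs. bd_bracket_term f a xs k l)"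
  proof (rule sum.reindex_bij_witness[of _ "\<lambda>(k, l). (?N - Suc l, ?N - Suc k)" "\<lambda>(i, j). (?N - Suc j, ?N - Suc i)"])
    fix ij assume "ij \<in> ?pairs"
    then obtain i j where ij: "ij = (i, j)" "i < j" "j < ?N"
      by auto
    then obtain A x M x' C where xs: "xs = A @ x # M @ x' # C" and C: "length C = i" and M: "length M + Suc i = j"
      using split_list_from_right2 by blast
    have "length (A @ x # M @ x' # C) = Suc n"
      using len xs by simp
    note match = bracket_terms_match[OF anti f this]
    from xs C M[symmetric] hxs ha show "(case (case ij of (i, j) \<Rightarrow> (?N - Suc j, ?N - Suc i)) of (k, l) \<Rightarrow> bd_bracket_term f a xs k l)
        = (case ij of (i, j) \<Rightarrow> sgn (par_sum V2 xs) * (\<Sum>p<2. d_bracket_term p f (rev (map t xs)) a i j))"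
      using match ij by (simp add: add.commute)
  qed auto
  finally show ?thesis .
qed

lemma sum_d_bracket_term_two:
  assumes f0: "f [0] = 0" and hx: "homog V2 x" and hy: "homog V2 y" and ha: "homog W2 a"
  shows "(\<Sum>p<2. d_bracket_term p f [t y, t x] a 0 1)
    = sgn ((par W2 a + ((par V2 x + par V2 y) mod 2 + 1)) mod 2 + (par V2 y + 1)
        + (par V2 y + 1 + par V2 y + 1) * (par V2 x + 1))
      * psi (f [br1 (t y) (t x)]) a"
proof -
  let ?U = "br1 (t y) (t x)" and ?r = "(par V2 x + par V2 y) mod 2"
  let ?E = "\<lambda>p. p + (par V2 y + 1) + (par V2 y + 1 + par V2 y + 1) * (par V2 x + 1)"
  have U: "?U \<in> V1 ?r"
    using br1_grade[OF homog_t[OF hy] homog_t[OF hx]] hx hy by (simp add: add.commute)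
  have "fcomp V1 W1 p f [?U] = proj W1 (p + (?r + 1)) (f [?U])" for p
    using par_eqI[OF V1_super _ U] f0
    by (cases "?U = 0") (simp_all add: fcomp_def kk_def proj_zero[OF W1_super])
  then have "(\<Sum>p<2. d_bracket_term p f [t y, t x] a 0 1)
      = (\<Sum>p<2. sgn (?E p) * psi (proj W1 (p + (?r + 1)) (f [?U])) a)"
    using hx hy by (simp add: d_bracket_term_def kk_def del_def)
  also have "\<dots> = sgn (?E ((par W2 a + (?r + 1)) mod 2)) * psi (f [?U]) a"
    by (rule psi_proj_select[OF par_less_2 in_grade_par[OF W2_super ha]])
  finally show ?thesis .
qed

end

locale invariant_pairing = dual_complexes +
  assumes psi_invariant: "psi m (act2 x a) = psi (act1 (t x) m) a"
begin

lemma act_terms_match: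
  assumes hA: "\<forall>y\<in>set A. homog V2 y" and hx: "homog V2 x" and hC: "\<forall>y\<in>set C. homog V2 y"
    and ha: "homog W2 a"
  shows "sgn (par_sum V2 (A @ x # C)) * (\<Sum>p<2. d_act_term p f (rev (map t (A @ x # C))) a (length C))
       = bd_act_term f a (A @ x # C) (length A)"
proof -
  let ?zs = "rev (map t (A @ C))" and ?b = "act2 x a"
  let ?kA = "shifted_par_sum V2 A" and ?kC = "shifted_par_sum V2 C"
  define r where "r = (par V2 x + par W2 a) mod 2"
  have r: "r < 2" and b: "?b \<in> W2 r"
    using act2_grade[OF hx ha] by (simp_all add: r_def)
  have "d_act_term p f (rev (map t (A @ x # C))) a (length C)
      = sgn (par V2 x + (p + ?kC) * (par V2 x + 1)) * psi (proj W1 (p + (?kC + ?kA)) (f ?zs)) ?b" for p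
    using hA hC hx
    by (simp add: d_act_term_def fcomp_def kk_eq_shifted_par_sum_take nth_append del_def psi_invariant)
  then have "(\<Sum>p<2. d_act_term p f (rev (map t (A @ x # C))) a (length C))
      = sgn (par V2 x + ((r + (?kC + ?kA)) mod 2 + ?kC) * (par V2 x + 1)) * psi (f ?zs) ?b"
    using psi_proj_select[OF r b] by simp
  moreover have "bd_act_term f a (A @ x # C) (length A)
      = sgn ((par W2 a + ?kA) * (par V2 x + 1)) * sgn (par_sum V2 (A @ C)) * psi (f ?zs) ?b"
    by (simp add: bd_act_term_def kk_eq_shifted_par_sum_take del_def)
  moreover have "sgn (par_sum V2 (A @ x # C)) * sgn (par V2 x + ((r + (?kC + ?kA)) mod 2 + ?kC) * (par V2 x + 1))
      = sgn ((par W2 a + ?kA) * (par V2 x + 1)) * sgn (par_sum V2 (A @ C))"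
    unfolding power_add[symmetric] r_def
    by (rule sgn_cong) (simp; argo)
  ultimately show ?thesis
    by (simp add: mult.assoc)
qed

lemma sum_act_terms_match:
  assumes hxs: "\<forall>x\<in>set xs. homog V2 x" and ha: "homog W2 a"
  shows "sgn (par_sum V2 xs) * (\<Sum>p<2. \<Sum>i<length xs. d_act_term p f (rev (map t xs)) a i)
    = (\<Sum>k<length xs. bd_act_term f a xs k)"
proof -
  have "sgn (par_sum V2 xs) * (\<Sum>p<2. \<Sum>i<length xs. d_act_term p f (rev (map t xs)) a i)
      = (\<Sum>i<length xs. sgn (par_sum V2 xs) * (\<Sum>p<2. d_act_term p f (rev (map t xs)) a i))"
    by (simp add: sum.swap[of _ "{..<2}"] sum_distrib_left)
  also have "\<dots> = (\<Sum>k<length xs. bd_act_term f a xs k)"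
  proof (rule sum.reindex_bij_witness[of _ "\<lambda>k. length xs - Suc k" "\<lambda>i. length xs - Suc i"])
    fix i assume "i \<in> {..<length xs}"
    then obtain A x C where xs: "xs = A @ x # C" and "length C = i"
      using split_list_from_right by blast
    with hxs ha show "bd_act_term f a xs (length xs - Suc i)
        = sgn (par_sum V2 xs) * (\<Sum>p<2. d_act_term p f (rev (map t xs)) a i)"
      using act_terms_match[of A x C a f] by simp
  qed auto
  finally show ?thesis .
qed

lemma adjoint_on_generator_iff_brackets_match:
  assumes "\<forall>x\<in>set xs. homog V2 x" and "homog W2 a"
  shows "sgn (par_sum V2 xs) * psi (dcoch scm1 V1 br1 W1 act1 f (rev (map t xs))) a
      = Psi_n V2 t psi f (bd_gen V2 br2 W2 act2 a xs)
    \<longleftrightarrow> sgn (par_sum V2 xs) *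
      (\<Sum>p<2. \<Sum>(i, j)\<in>{(i, j). i < j \<and> j < length xs}. d_bracket_term p f (rev (map t xs)) a i j)
    = (\<Sum>(k, l)\<in>{(k, l). k < l \<and> l < length xs}. bd_bracket_term f a xs k l)"
  using sum_act_terms_match[OF assms, of f] by (simp add: psi_dcoch Psi_n_bd_gen distrib_left)

lemma adjoint_on_generators_if_anti:
  assumes anti: "\<And>x y. t (br2 x y) = br1 (t y) (t x)" and f: "cochain sc1 V1 scm1 n f"
  shows "adjoint_on_generators n f"
  unfolding adjoint_on_generators_def
  using adjoint_on_generator_iff_brackets_match sum_bracket_terms_match[OF anti f] by simp

lemma anti_if_adjoint_degree_one:
  assumes adjoint: "\<And>f. cochain sc1 V1 scm1 1 f \<Longrightarrow> adjoint_on_generators 1 f"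
    and ha: "homog W2 a" and nz: "psi m a \<noteq> 0" and hx: "homog V2 x" and hy: "homog V2 y"
  shows "t (br2 x y) = br1 (t y) (t x)"
proof (rule vector_space.linear_functionals_separate[OF super_space_vector_space[OF V1_super]])
  fix \<phi>
  assume \<phi>: "Vector_Spaces.linear sc1 (*) \<phi>"
  define f where "f = (\<lambda>zs. scm1 (\<phi> (hd zs)) m)"
  have f: "cochain sc1 V1 scm1 1 f"
    unfolding f_def
    by (rule cochain_degree_one[OF vector_space.linear_scale_by_functional[OF super_space_vector_space[OF W1_super] \<phi>]])
  have f_zero: "f [0] = 0"
    using linear_map_zero[OF \<phi>] module.scale_zero_left[of scm1] super_space_vector_space[OF W1_super]
    by (simp add: f_def module_iff_vector_space)
  have psi_f: "psi (f [z]) a = \<phi> z * psi m a" for z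
    by (simp add: f_def psi_scale_left)
  define r where "r = (par V2 x + par V2 y) mod 2"
  let ?b = "br2 x y"
  have sgn_b: "sgn (par V2 ?b) * \<phi> (t ?b) = sgn r * \<phi> (t ?b)"
    using par_eqI[OF V2_super _ br2_grade[OF hx hy]] linear_map_zero[OF \<phi>]
    by (cases "?b = 0") (simp_all add: r_def)
  let ?L = "(par W2 a + (r + 1)) mod 2 + (par V2 y + 1) + (par V2 y + 1 + par V2 y + 1) * (par V2 x + 1)"
  let ?R = "1 + par W2 a + (par V2 x + 1) + (par V2 x + 1 + par V2 x + 1) * (par V2 y + 1)"
  have sign: "sgn (par_sum V2 [x, y]) * sgn ?L = sgn ?R * sgn r"
    unfolding power_add[symmetric] r_def by (rule sgn_cong) (simp; argo)
  have pairs: "{(i, j). i < j \<and> j < Suc (Suc 0)} = {(0::nat, 1::nat)}"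
    by auto
  have "sgn ?R * sgn r * (\<phi> (t ?b) * psi m a) = bd_bracket_term f a [x, y] 0 1"
    using sgn_b by (auto simp: bd_bracket_term_def kk_def del_def psi_f)
  also have "\<dots> = sgn (par_sum V2 [x, y]) * (\<Sum>p<2. d_bracket_term p f [t y, t x] a 0 1)"
    using adjoint[OF f, unfolded adjoint_on_generators_def, rule_format, of a "[x, y]"]
      adjoint_on_generator_iff_brackets_match[of "[x, y]" a f] hx hy ha
    by (auto simp: pairs)
  also have "\<dots> = sgn (par_sum V2 [x, y]) * sgn ?L * psi (f [br1 (t y) (t x)]) a"
    unfolding sum_d_bracket_term_two[of f, OF f_zero hx hy ha] r_def by (simp only: mult.assoc)
  finally have "sgn ?R * sgn r * (\<phi> (t ?b) * psi m a) = sgn ?R * sgn r * (\<phi> (br1 (t y) (t x)) * psi m a)"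
    by (simp only: sign psi_f mult.assoc[symmetric])
  with nz show "\<phi> (t ?b) = \<phi> (br1 (t y) (t x))"
    by simp
qed

end

lemma (in dual_complexes) adjoint_iff_anti_and_invariant:
  assumes "\<exists>m::'m1. m \<noteq> 0"
  shows "(\<forall>n f. cochain sc1 V1 scm1 n f \<longrightarrow> adjoint_on_generators n f)
    \<longleftrightarrow> (\<forall>x y. t (br2 x y) = br1 (t y) (t x)) \<and> (\<forall>x m a. psi m (act2 x a) = psi (act1 (t x) m) a)"
proof
  assume "\<forall>n f. cochain sc1 V1 scm1 n f \<longrightarrow> adjoint_on_generators n f"
  then have adjoint: "\<And>n f. cochain sc1 V1 scm1 n f \<Longrightarrow> adjoint_on_generators n f"
    by blast
  have invariant: "psi m (act2 x a) = psi (act1 (t x) m) a" for x m a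
    using invariance_if_invariant_on_homog invariance_if_adjoint_degree_zero adjoint by blast
  then interpret invariant_pairing sc1 V1 br1 sc2 V2 br2 scm1 W1 act1 scm2 W2 act2 t psi
    by unfold_locales
  obtain m a where "homog W2 a" "psi m a \<noteq> 0"
    using exists_pairing_nonzero_homog[OF assms] .
  then have "t (br2 x y) = br1 (t y) (t x)" for x y
    using anti_if_anti_on_homog anti_if_adjoint_degree_one adjoint by blast
  with invariant show "(\<forall>x y. t (br2 x y) = br1 (t y) (t x)) \<and> (\<forall>x m a. psi m (act2 x a) = psi (act1 (t x) m) a)"
    by blast
next
  assume anti_and_invariant: "(\<forall>x y. t (br2 x y) = br1 (t y) (t x)) \<and> (\<forall>x m a. psi m (act2 x a) = psi (act1 (t x) m) a)"
  then interpret invariant_pairing sc1 V1 br1 sc2 V2 br2 scm1 W1 act1 scm2 W2 act2 t psi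
    by unfold_locales blast
  show "\<forall>n f. cochain sc1 V1 scm1 n f \<longrightarrow> adjoint_on_generators n f"
    using adjoint_on_generators_if_anti anti_and_invariant by blast
qed

theorem propositionA5:
  fixes sc1 :: "complex \<Rightarrow> 'g1::ab_group_add \<Rightarrow> 'g1" and V1 :: "nat \<Rightarrow> 'g1 set" and br1 :: "'g1 \<Rightarrow> 'g1 \<Rightarrow> 'g1"
    and sc2 :: "complex \<Rightarrow> 'g2::ab_group_add \<Rightarrow> 'g2" and V2 :: "nat \<Rightarrow> 'g2 set" and br2 :: "'g2 \<Rightarrow> 'g2 \<Rightarrow> 'g2"
    and scm1 :: "complex \<Rightarrow> 'm1::ab_group_add \<Rightarrow> 'm1" and W1 :: "nat \<Rightarrow> 'm1 set" and act1 :: "'g1 \<Rightarrow> 'm1 \<Rightarrow> 'm1"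
    and scm2 :: "complex \<Rightarrow> 'm2::ab_group_add \<Rightarrow> 'm2" and W2 :: "nat \<Rightarrow> 'm2 set" and act2 :: "'g2 \<Rightarrow> 'm2 \<Rightarrow> 'm2"
    and t :: "'g2 \<Rightarrow> 'g1" and psi :: "'m1 \<Rightarrow> 'm2 \<Rightarrow> complex"
  assumes "lie_superalgebra sc1 V1 br1" and "lie_superalgebra sc2 V2 br2"
    and "lie_supermodule sc1 V1 br1 scm1 W1 act1" and "lie_supermodule sc2 V2 br2 scm2 W2 act2"
    and "even_linear_iso sc2 V2 sc1 V1 t"
    and "nondeg_even_pairing scm1 W1 scm2 W2 psi"
    and "\<exists>m::'m1. m \<noteq> 0"
  shows "(\<forall>n f P. cochain sc1 V1 scm1 n f \<longrightarrow> is_chain V2 W2 (Suc n) P \<longrightarrow>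
            Psi_n V2 t psi (dcoch scm1 V1 br1 W1 act1 f) P = Psi_n V2 t psi f (bd V2 br2 W2 act2 P))
     \<longleftrightarrow> (lie_anti_iso sc2 br2 sc1 br1 t
          \<and> (\<forall>x m1 m2. psi m1 (act2 x m2) = psi (act1 (t x) m1) m2))"
proof -
  interpret dual_complexes sc1 V1 br1 sc2 V2 br2 scm1 W1 act1 scm2 W2 act2 t psi
    using assms(1-6) by unfold_locales
  show ?thesis
    using adjoint_iff_anti_and_invariant[OF assms(7)] adjoint_iff_adjoint_on_generators t_linear t_bij
    unfolding lie_anti_iso_def by blast
qed

end
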